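(* Let $A\in\mathbb{R}^{m\times n}$ with $m<n$, $\boldsymbol b\in\mathbb{R}^m$ with $\boldsymbol b\neq\mathbf 0$, and $\mu>0$. Assume that every submatrix of $A$ formed by $n-1$ of its columns has rank $m$. A vector $\widehat{\boldsymbol x}\in\mathbb{R}^n$ is a local minimizer of $$\min_{\boldsymbol x\in\mathbb{R}^n,\ A\boldsymbol x=\boldsymbol b}\Phi_\mu(\boldsymbol x)$$ if and only if $|\widehat{\boldsymbol x}_i|\neq\mu$ for all $i=1,\dots,n$ and there exists $\widehat{\boldsymbol y}\in\mathbb{R}^m$ such that $$\tfrac{2}{\mu^2}(\mathbf 1-\widehat{\boldsymbol\omega})\circ\widehat{\boldsymbol x}+A^\top\widehat{\boldsymbol y}=\mathbf 0\quad\text{and}\quad A\widehat{\boldsymbol x}=\boldsymbol b,$$ where $\widehat{\boldsymbol\omega}=\mathcal H_\mu(\widehat{\boldsymbol x})$.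
   Context: The truncated Huber function with parameter $\mu>0$ is $\phi_\mu(x)=\min(1,x^2/\mu^2)$ for $x\in\mathbb{R}$, and $\Phi_\mu(\boldsymbol x)=\sum_{i=1}^n\phi_\mu(\boldsymbol x_i)$ for $\boldsymbol x\in\mathbb{R}^n$. The operator $\mathcal H_\mu:\mathbb{R}^n\to\{0,1\}^n$ is defined componentwise by $(\mathcal H_\mu(\boldsymbol x))_i=0$ if $|\boldsymbol x_i|\le\mu$ and $(\mathcal H_\mu(\boldsymbol x))_i=1$ if $|\boldsymbol x_i|>\mu$. $\circ$ is the Hadamard (entrywise) product and $\mathbf 1$ the all-ones vector. *)

theory Defs
  imports "HOL-Analysis.Analysis"
begin

definition trunc_huber :: "real \<Rightarrow> real \<Rightarrow> real"
  where "trunc_huber \<mu> x = min 1 (x\<^sup>2 / \<mu>\<^sup>2)"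

definition trunc_huber_sum :: "real \<Rightarrow> real ^ 'n \<Rightarrow> real"
  where "trunc_huber_sum \<mu> x = (\<Sum>i\<in>UNIV. trunc_huber \<mu> (x $ i))"

definition huber_indicator :: "real \<Rightarrow> real ^ 'n \<Rightarrow> real ^ 'n"
  where "huber_indicator \<mu> x = (\<chi> i. if \<bar>x $ i\<bar> \<le> \<mu> then 0 else 1)"

(* The columns of A selected by s, in the order given by the index type 'k; it is a
   genuine submatrix of A exactly when s is injective. *)
definition column_submatrix :: "('k \<Rightarrow> 'n) \<Rightarrow> 'a ^ 'n ^ 'm \<Rightarrow> 'a ^ 'k ^ 'm"
  where "column_submatrix s A = (\<chi> i j. A $ i $ s j)"

(* Local minimality relative to the feasible set S; in particular x is feasible. *)
definition local_minimizer_on :: "('a::metric_space \<Rightarrow> real) \<Rightarrow> 'a set \<Rightarrow> 'a \<Rightarrow> bool"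
  where "local_minimizer_on f S x \<longleftrightarrow>
    x \<in> S \<and> (\<exists>\<epsilon>>0. \<forall>z\<in>S. dist z x < \<epsilon> \<longrightarrow> f x \<le> f z)"

end

theory Submission
  imports Defs
begin

text \<open>
  The truncated Huber function is the minimum of a parabola and the constant \<open>1\<close>, and near a
  point \<open>a\<close> only the branches that attain this minimum at \<open>a\<close> matter: the parabola when
  \<open>\<bar>a\<bar> < \<mu>\<close>, the constant when \<open>\<bar>a\<bar> > \<mu>\<close>, and either of them at the kinks \<open>\<bar>a\<bar> = \<mu>\<close>.
  Choosing one active branch in each coordinate of \<open>x\<close> gives a quadratic function that lies above
  \<open>\<Phi>\<^sub>\<mu>\<close> everywhere and agrees with it at \<open>x\<close>.

  If \<open>x\<close> is a local minimizer on \<open>A x = b\<close>, it therefore also minimizes each of these quadratic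
  majorants locally, so the gradient of each of them is orthogonal to the kernel of \<open>A\<close>, that is, it
  lies in the row space of \<open>A\<close> (lemma \<open>local_minimizer_imp_branch_gradient_rowspace\<close>). For the
  selection \<open>\<H>\<^sub>\<mu>(x)\<close> this is the stationarity equation. If some \<open>\<bar>x\<^sub>j\<bar>\<close> were equal to \<open>\<mu>\<close>, the two
  selections that differ only at \<open>j\<close> would both be available; the difference of their gradients is a
  nonzero multiple of the \<open>j\<close>-th unit vector, which would then be \<open>A\<^sup>T y\<close> for some \<open>y \<noteq> 0\<close>. Such a
  \<open>y\<close> is a linear dependence between the rows of \<open>A\<close> with column \<open>j\<close> deleted, against the rank
  hypothesis (lemma \<open>axis_notin_rowspace\<close>).

  Conversely, away from the kinks \<open>\<Phi>\<^sub>\<mu>\<close> coincides near \<open>x\<close> with one such quadratic function, which is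
  convex. So \<open>\<Phi>\<^sub>\<mu>\<close> lies above its linearization near \<open>x\<close>, and the linear term vanishes on the
  kernel of \<open>A\<close> by the stationarity equation.
\<close>

section \<open>Row space and kernel\<close>

text \<open>
  Split \<open>g\<close> into its projection onto the row space and a remainder \<open>v\<close>. The remainder is
  orthogonal to \<open>A\<^sup>T (A v)\<close>, which forces \<open>A v = 0\<close>; then \<open>g\<close> is orthogonal to \<open>v\<close>, so \<open>v = 0\<close>.
\<close>

lemma orthogonal_kernel_imp_rowspace:
  fixes A :: "real ^ 'n ^ 'm" and g :: "real ^ 'n"
  assumes "\<And>d. A *v d = 0 \<Longrightarrow> g \<bullet> d = 0"
  shows "\<exists>y. g = transpose A *v y"
proof -
  let ?R = "range (\<lambda>y. transpose A *v y)"
  have sub: "subspace ?R"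
    by (rule linear_subspace_image[OF matrix_vector_mul_linear subspace_UNIV])
  obtain u v where u: "u \<in> span ?R" and v: "\<And>w. w \<in> span ?R \<Longrightarrow> orthogonal v w"
      and g: "g = u + v"
    using orthogonal_subspace_decomp_exists by blast
  have u': "u \<in> ?R" using u sub span_eq_iff by blast
  have orth: "v \<bullet> (transpose A *v y) = 0" for y
    using v[of "transpose A *v y"] by (simp add: orthogonal_def span_base)
  have "(A *v v) \<bullet> (A *v v) = 0"
    using orth[of "A *v v"] by (metis dot_lmul_matrix inner_commute transpose_matrix_vector)
  then have "A *v v = 0" by simp
  then have "g \<bullet> v = 0" using assms by blast
  moreover have "u \<bullet> v = 0" using v[OF u] by (simp add: orthogonal_def inner_commute)
  ultimately have "v = 0" by (simp add: g inner_add_left)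
  then show ?thesis using u' g by auto
qed

text \<open>
  A preimage \<open>y\<close> of the unit vector under \<open>A\<^sup>T\<close> is annihilated by every column other than the
  \<open>j\<close>-th one, hence by the transpose of the submatrix that consists of these columns. Full row rank
  makes that transpose injective, so \<open>y = 0\<close>.
\<close>

lemma axis_notin_rowspace:
  fixes A :: "real ^ 'n ^ 'm"
  assumes card: "CARD('k::finite) = CARD('n) - 1"
    and rank: "\<And>s :: 'k \<Rightarrow> 'n. inj s \<Longrightarrow> rank (column_submatrix s A) = CARD('m)"
  shows "transpose A *v y \<noteq> axis j 1"
proof
  assume y: "transpose A *v y = axis j 1"
  have "card (UNIV :: 'k set) = card (UNIV - {j})"
    using card by simp
  then obtain s :: "'k \<Rightarrow> 'n" where s: "bij_betw s UNIV (UNIV - {j})"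
    using finite_same_card_bij[of "UNIV :: 'k set" "UNIV - {j}"] by auto
  let ?B = "column_submatrix s A"
  have "inj s" using s by (simp add: bij_betw_def)
  then have "inj ((*v) (transpose ?B))"
    using rank full_rank_injective[of "transpose ?B"] by (simp add: rank_transpose)
  moreover have "transpose ?B *v y = 0"
  proof (rule vec_eq_iff[THEN iffD2], rule allI)
    fix i
    have "s i \<noteq> j" using s by (auto simp: bij_betw_def)
    then have "(transpose A *v y) $ s i = 0" unfolding y by (simp add: axis_def)
    then show "(transpose ?B *v y) $ i = 0 $ i"
      by (simp del: transpose_matrix_vector add: matrix_vector_mult_def transpose_def column_submatrix_def)
  qed
  ultimately have "y = 0"
    by (metis injD matrix_vector_mult_0_right)
  then have "axis j (1::real) = 0" using y by simp
  then show False by (simp add: axis_eq_0_iff)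
qed

section \<open>Quadratic majorants from active branches\<close>

text \<open>
  The encoding of a choice of branches follows the indicator \<open>\<H>\<^sub>\<mu>\<close>: the value \<open>0\<close> stands for the
  parabola and \<open>1\<close> for the constant. At a kink both values are admissible.
\<close>

definition active_selection :: "real \<Rightarrow> real ^ 'n \<Rightarrow> real ^ 'n \<Rightarrow> bool"
  where "active_selection \<mu> x w \<longleftrightarrow>
    (\<forall>i. w $ i = 0 \<and> \<bar>x $ i\<bar> \<le> \<mu> \<or> w $ i = 1 \<and> \<mu> \<le> \<bar>x $ i\<bar>)"

definition branch_gradient :: "real \<Rightarrow> real ^ 'n \<Rightarrow> real ^ 'n \<Rightarrow> real ^ 'n"
  where "branch_gradient \<mu> w x = (2 / \<mu>\<^sup>2) *\<^sub>R ((1 - w) * x)"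

lemma active_selection_huber_indicator: "active_selection \<mu> x (huber_indicator \<mu> x)"
  by (simp add: active_selection_def huber_indicator_def)

lemma inner_branch_gradient:
  "branch_gradient \<mu> w x \<bullet> h = (\<Sum>i\<in>UNIV. 2 / \<mu>\<^sup>2 * (1 - w $ i) * x $ i * h $ i)"
  by (simp add: branch_gradient_def inner_vec_def algebra_simps diff_divide_distrib)

lemma trunc_huber_inside:
  assumes "\<mu> > 0" and "\<bar>a\<bar> \<le> \<mu>"
  shows "trunc_huber \<mu> a = a\<^sup>2 / \<mu>\<^sup>2"
proof -
  have "a\<^sup>2 \<le> \<mu>\<^sup>2" using assms by (simp add: abs_le_square_iff[symmetric])
  then show ?thesis using assms by (simp add: trunc_huber_def min_def field_simps)
qed

lemma trunc_huber_outside: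
  assumes "\<mu> > 0" and "\<mu> \<le> \<bar>a\<bar>"
  shows "trunc_huber \<mu> a = 1"
proof -
  have "\<mu>\<^sup>2 \<le> a\<^sup>2" using assms by (simp add: abs_le_square_iff[symmetric])
  then show ?thesis using assms by (simp add: trunc_huber_def min_def field_simps)
qed

lemma trunc_huber_le_branch:
  assumes "\<mu> > 0" and "w = 0 \<and> \<bar>a\<bar> \<le> \<mu> \<or> w = 1 \<and> \<mu> \<le> \<bar>a\<bar>"
  shows "trunc_huber \<mu> (a + s) \<le> trunc_huber \<mu> a + 2 / \<mu>\<^sup>2 * (1 - w) * a * s + s\<^sup>2 / \<mu>\<^sup>2"
  using assms(2)
proof (elim disjE conjE)
  assume w: "w = 0" and a: "\<bar>a\<bar> \<le> \<mu>"
  have "trunc_huber \<mu> (a + s) \<le> (a + s)\<^sup>2 / \<mu>\<^sup>2" by (simp add: trunc_huber_def)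
  also have "\<dots> = a\<^sup>2 / \<mu>\<^sup>2 + 2 / \<mu>\<^sup>2 * (1 - w) * a * s + s\<^sup>2 / \<mu>\<^sup>2"
    by (simp add: w power2_sum add_divide_distrib)
  finally show ?thesis using trunc_huber_inside[OF assms(1) a] by simp
next
  assume w: "w = 1" and a: "\<mu> \<le> \<bar>a\<bar>"
  have "trunc_huber \<mu> (a + s) \<le> 1" by (simp add: trunc_huber_def)
  then show ?thesis using trunc_huber_outside[OF assms(1) a] w
    by (simp add: add_increasing2)
qed

lemma trunc_huber_sum_le_branch:
  fixes x h w :: "real ^ 'n"
  assumes "\<mu> > 0" and "active_selection \<mu> x w"
  shows "trunc_huber_sum \<mu> (x + h)
    \<le> trunc_huber_sum \<mu> x + branch_gradient \<mu> w x \<bullet> h + (norm h)\<^sup>2 / \<mu>\<^sup>2"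
proof -
  have "trunc_huber_sum \<mu> (x + h) \<le> (\<Sum>i\<in>UNIV. trunc_huber \<mu> (x $ i)
      + 2 / \<mu>\<^sup>2 * (1 - w $ i) * x $ i * h $ i + (h $ i)\<^sup>2 / \<mu>\<^sup>2)"
    unfolding trunc_huber_sum_def vector_add_component
    by (intro sum_mono trunc_huber_le_branch)
      (use assms in \<open>auto simp: active_selection_def\<close>)
  also have "\<dots> = trunc_huber_sum \<mu> x + branch_gradient \<mu> w x \<bullet> h + (norm h)\<^sup>2 / \<mu>\<^sup>2"
  proof -
    have "(norm h)\<^sup>2 = (\<Sum>i\<in>UNIV. (h $ i)\<^sup>2)"
      unfolding power2_norm_eq_inner by (simp add: inner_vec_def power2_eq_square)
    then show ?thesis
      by (simp add: trunc_huber_sum_def inner_branch_gradient sum.distrib sum_divide_distrib)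
  qed
  finally show ?thesis .
qed

text \<open>
  Along a feasible direction \<open>d\<close> the majorant gives
  \<open>0 \<le> t (g \<bullet> d) + t\<^sup>2 \<parallel>d\<parallel>\<^sup>2 / \<mu>\<^sup>2\<close> for small \<open>t > 0\<close>; dividing by \<open>t\<close> and letting \<open>t\<close>
  tend to \<open>0\<close> leaves \<open>g \<bullet> d \<ge> 0\<close>. The opposite direction gives the reverse inequality.
\<close>

lemma local_minimizer_imp_branch_gradient_rowspace:
  fixes A :: "real ^ 'n ^ 'm"
  assumes "\<mu> > 0"
    and min: "local_minimizer_on (trunc_huber_sum \<mu>) {z. A *v z = b} x"
    and sel: "active_selection \<mu> x w"
  shows "\<exists>y. branch_gradient \<mu> w x = transpose A *v y"
proof (rule orthogonal_kernel_imp_rowspace)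
  let ?g = "branch_gradient \<mu> w x"
  from min obtain \<epsilon> where feas: "A *v x = b" and "\<epsilon> > 0"
    and le: "\<And>z. A *v z = b \<Longrightarrow> dist z x < \<epsilon> \<Longrightarrow> trunc_huber_sum \<mu> x \<le> trunc_huber_sum \<mu> z"
    by (auto simp: local_minimizer_on_def)
  have nonneg: "?g \<bullet> d \<ge> 0" if d: "A *v d = 0" for d
  proof -
    have "((\<lambda>t. ?g \<bullet> d + t * ((norm d)\<^sup>2 / \<mu>\<^sup>2)) \<longlongrightarrow> ?g \<bullet> d + 0 * ((norm d)\<^sup>2 / \<mu>\<^sup>2)) (at_right 0)"
      by (intro tendsto_intros)
    moreover have "\<forall>\<^sub>F t in at_right 0. 0 \<le> ?g \<bullet> d + t * ((norm d)\<^sup>2 / \<mu>\<^sup>2)"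
    proof -
      have "((\<lambda>t. norm (t *\<^sub>R d)) \<longlongrightarrow> norm (0 *\<^sub>R d)) (at_right (0::real))"
        by (intro tendsto_intros)
      then have "\<forall>\<^sub>F t in at_right (0::real). norm (t *\<^sub>R d) < \<epsilon>"
        by (rule order_tendstoD(2)) (use \<open>\<epsilon> > 0\<close> in simp)
      moreover have "\<forall>\<^sub>F t in at_right (0::real). t > 0"
        by (simp add: eventually_at_right_less)
      ultimately show ?thesis
      proof eventually_elim
        case (elim t)
        have "A *v (x + t *\<^sub>R d) = b"
          by (simp add: matrix_vector_right_distrib scaleR_matrix_vector_assoc[symmetric] feas d
              matrix_vector_mult_scaleR)
        then have "trunc_huber_sum \<mu> x \<le> trunc_huber_sum \<mu> (x + t *\<^sub>R d)"
          using le elim(1) by (simp add: dist_norm)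
        also note trunc_huber_sum_le_branch[OF assms(1) sel, of "t *\<^sub>R d"]
        finally have "0 \<le> t * (?g \<bullet> d + t * ((norm d)\<^sup>2 / \<mu>\<^sup>2))"
          by (simp add: power_mult_distrib algebra_simps power2_eq_square)
        then show ?case using elim(2) by (simp add: zero_le_mult_iff)
      qed
    qed
    ultimately have "0 \<le> ?g \<bullet> d + 0 * ((norm d)\<^sup>2 / \<mu>\<^sup>2)"
      by (rule tendsto_lowerbound) simp
    then show ?thesis by simp
  qed
  fix d assume "A *v d = 0"
  moreover from this have "A *v (- d) = 0"
    using matrix_vector_mult_diff_distrib[of A 0 d] by simp
  ultimately show "?g \<bullet> d = 0" using nonneg[of d] nonneg[of "- d"] by simp
qed

text \<open>
  With the kink at coordinate \<open>j\<close>, raising the selection from \<open>0\<close> to \<open>1\<close> there keeps it active and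
  subtracts \<open>2 x\<^sub>j / \<mu>\<^sup>2\<close> times the \<open>j\<close>-th unit vector from the gradient; the factor is nonzero
  because \<open>\<bar>x\<^sub>j\<bar> = \<mu> > 0\<close>.
\<close>

lemma local_minimizer_at_kink_imp_axis_rowspace:
  fixes A :: "real ^ 'n ^ 'm"
  assumes "\<mu> > 0"
    and min: "local_minimizer_on (trunc_huber_sum \<mu>) {z. A *v z = b} x"
    and kink: "\<bar>x $ j\<bar> = \<mu>"
  shows "\<exists>y. transpose A *v y = axis j 1"
proof -
  let ?w = "huber_indicator \<mu> x"
  let ?w' = "?w + axis j 1"
  let ?c = "2 / \<mu>\<^sup>2 * x $ j"
  have "?w $ j = 0" using kink by (simp add: huber_indicator_def)
  then have "active_selection \<mu> x ?w'"
    using active_selection_huber_indicator[of \<mu> x] kink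
    by (auto simp: active_selection_def axis_def)
  then obtain y' where y': "branch_gradient \<mu> ?w' x = transpose A *v y'"
    using local_minimizer_imp_branch_gradient_rowspace[OF assms(1) min] by blast
  obtain y where y: "branch_gradient \<mu> ?w x = transpose A *v y"
    using local_minimizer_imp_branch_gradient_rowspace[OF assms(1) min
        active_selection_huber_indicator] by blast
  have "?c \<noteq> 0" using kink assms(1) by auto
  have "?c *\<^sub>R axis j 1 = branch_gradient \<mu> ?w x - branch_gradient \<mu> ?w' x"
    by (simp add: vec_eq_iff branch_gradient_def axis_def algebra_simps)
  also have "\<dots> = transpose A *v (y - y')"
    by (simp only: y y' matrix_vector_mult_diff_distrib)
  finally have "transpose A *v ((1 / ?c) *\<^sub>R (y - y')) = (1 / ?c) *\<^sub>R ?c *\<^sub>R axis j 1"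
    by (simp only: matrix_vector_mult_scaleR)
  also have "\<dots> = axis j 1" using \<open>?c \<noteq> 0\<close> by simp
  finally show ?thesis by blast
qed

section \<open>Sufficiency: a convex minorant away from the kinks\<close>

text \<open>
  The bound on \<open>s\<close> is the distance from \<open>a\<close> to the nearest kink: it keeps \<open>a + s\<close> on the branch
  of \<open>a\<close>, where the function is convex. No such bound can work at a kink, which is a concave corner.
\<close>

lemma trunc_huber_ge_linear:
  assumes "\<mu> > 0" and "\<bar>s\<bar> < \<bar>\<bar>a\<bar> - \<mu>\<bar>"
  shows "trunc_huber \<mu> a + 2 / \<mu>\<^sup>2 * (1 - (if \<bar>a\<bar> \<le> \<mu> then 0 else 1)) * a * s
    \<le> trunc_huber \<mu> (a + s)"
proof (cases "\<bar>a\<bar> \<le> \<mu>")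
  case True
  then have "\<bar>a + s\<bar> \<le> \<mu>" using assms by linarith
  then have "trunc_huber \<mu> (a + s) = (a + s)\<^sup>2 / \<mu>\<^sup>2"
    using trunc_huber_inside assms(1) by blast
  also have "\<dots> = trunc_huber \<mu> a + 2 / \<mu>\<^sup>2 * a * s + s\<^sup>2 / \<mu>\<^sup>2"
    by (simp add: trunc_huber_inside[OF assms(1) True] power2_sum add_divide_distrib)
  finally show ?thesis using True by simp
next
  case False
  then have "\<mu> \<le> \<bar>a + s\<bar>" using assms by linarith
  then show ?thesis using False trunc_huber_outside[OF assms(1)] by simp
qed

lemma stationary_imp_local_minimizer:
  fixes A :: "real ^ 'n ^ 'm"
  assumes "\<mu> > 0"
    and smooth: "\<And>i. \<bar>x $ i\<bar> \<noteq> \<mu>"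
    and stat: "branch_gradient \<mu> (huber_indicator \<mu> x) x = transpose A *v y"
    and feas: "A *v x = b"
  shows "local_minimizer_on (trunc_huber_sum \<mu>) {z. A *v z = b} x"
proof -
  let ?g = "branch_gradient \<mu> (huber_indicator \<mu> x) x"
  define \<epsilon> where "\<epsilon> = Min (range (\<lambda>i. \<bar>\<bar>x $ i\<bar> - \<mu>\<bar>))"
  have "\<epsilon> > 0" using smooth by (simp add: \<epsilon>_def)
  moreover have "trunc_huber_sum \<mu> x \<le> trunc_huber_sum \<mu> z"
    if z: "A *v z = b" and dist: "dist z x < \<epsilon>" for z
  proof -
    have "\<bar>(z - x) $ i\<bar> < \<bar>\<bar>x $ i\<bar> - \<mu>\<bar>" for i
    proof -
      have "\<bar>(z - x) $ i\<bar> \<le> norm (z - x)" by (rule component_le_norm_cart)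
      also have "\<dots> < \<epsilon>" using dist by (simp add: dist_norm)
      also have "\<epsilon> \<le> \<bar>\<bar>x $ i\<bar> - \<mu>\<bar>" by (simp add: \<epsilon>_def)
      finally show ?thesis .
    qed
    then have "(\<Sum>i\<in>UNIV. trunc_huber \<mu> (x $ i)
        + 2 / \<mu>\<^sup>2 * (1 - huber_indicator \<mu> x $ i) * x $ i * (z - x) $ i)
      \<le> (\<Sum>i\<in>UNIV. trunc_huber \<mu> (x $ i + (z - x) $ i))"
      unfolding huber_indicator_def vec_lambda_beta
      by (intro sum_mono trunc_huber_ge_linear[OF assms(1)])
    then have "trunc_huber_sum \<mu> x + ?g \<bullet> (z - x) \<le> trunc_huber_sum \<mu> z"
      by (simp add: trunc_huber_sum_def inner_branch_gradient sum.distrib)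
    moreover have "?g \<bullet> (z - x) = y \<bullet> (A *v (z - x))"
      by (simp add: stat dot_lmul_matrix transpose_matrix_vector)
    moreover have "A *v (z - x) = 0"
      by (simp add: matrix_vector_mult_diff_distrib z feas)
    ultimately show ?thesis by simp
  qed
  ultimately show ?thesis using feas by (auto simp: local_minimizer_on_def)
qed

section \<open>Characterization of the local minimizers\<close>

theorem theorem2p7:
  fixes A :: "real ^ 'n ^ 'm" and b :: "real ^ 'm" and \<mu> :: real and x :: "real ^ 'n"
  assumes "CARD('m) < CARD('n)"
    and "b \<noteq> 0"
    and "\<mu> > 0"
    and "CARD('k::finite) = CARD('n) - 1"
    and "\<And>s :: 'k \<Rightarrow> 'n. inj s \<Longrightarrow> rank (column_submatrix s A) = CARD('m)"
  shows "local_minimizer_on (trunc_huber_sum \<mu>) {z. A *v z = b} x \<longleftrightarrow>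
    (\<forall>i. \<bar>x $ i\<bar> \<noteq> \<mu>) \<and>
    (\<exists>y :: real ^ 'm.
      (2 / \<mu>\<^sup>2) *\<^sub>R ((1 - huber_indicator \<mu> x) * x) + transpose A *v y = 0 \<and>
      A *v x = b)"
proof
  assume min: "local_minimizer_on (trunc_huber_sum \<mu>) {z. A *v z = b} x"
  have "\<bar>x $ i\<bar> \<noteq> \<mu>" for i
    using local_minimizer_at_kink_imp_axis_rowspace[OF assms(3) min]
      axis_notin_rowspace[OF assms(4,5)] by blast
  moreover obtain y where y: "branch_gradient \<mu> (huber_indicator \<mu> x) x = transpose A *v y"
    using local_minimizer_imp_branch_gradient_rowspace[OF assms(3) min
        active_selection_huber_indicator] by blast
  moreover have "transpose A *v (- y) = - (transpose A *v y)"
    using matrix_vector_mult_diff_distrib[of "transpose A" 0 y] by simp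
  moreover have "A *v x = b" using min by (simp add: local_minimizer_on_def)
  ultimately show "(\<forall>i. \<bar>x $ i\<bar> \<noteq> \<mu>) \<and>
    (\<exists>y :: real ^ 'm.
      (2 / \<mu>\<^sup>2) *\<^sub>R ((1 - huber_indicator \<mu> x) * x) + transpose A *v y = 0 \<and>
      A *v x = b)"
    unfolding branch_gradient_def by (metis add.right_inverse)
next
  assume kkt: "(\<forall>i. \<bar>x $ i\<bar> \<noteq> \<mu>) \<and>
    (\<exists>y :: real ^ 'm.
      (2 / \<mu>\<^sup>2) *\<^sub>R ((1 - huber_indicator \<mu> x) * x) + transpose A *v y = 0 \<and>
      A *v x = b)"
  then obtain y where "branch_gradient \<mu> (huber_indicator \<mu> x) x + transpose A *v y = 0"
    and feas: "A *v x = b" by (auto simp: branch_gradient_def)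
  moreover have "transpose A *v (- y) = - (transpose A *v y)"
    using matrix_vector_mult_diff_distrib[of "transpose A" 0 y] by simp
  ultimately have "branch_gradient \<mu> (huber_indicator \<mu> x) x = transpose A *v (- y)"
    by (metis eq_neg_iff_add_eq_0)
  then show "local_minimizer_on (trunc_huber_sum \<mu>) {z. A *v z = b} x"
    using stationary_imp_local_minimizer[OF assms(3)] kkt feas by blast
qed

end
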